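(* Let $n$ be a positive integer, let $D_n$ be a maximal Diophantine graph of order $n$, let $\pi(n)$ be the number of primes not exceeding $n$, and let $p_1,\dots,p_{\pi(n)}$ be the distinct primes not exceeding $n$. Then $$|E(D_n)|=C(n,2)-\sum_{1\leq i\leq \pi(n)} C\left(\left\lfloor\frac{n}{p_i^{\acute{v}_{p_i}(n)}}\right\rfloor, 2\right)+\sum_{1\leq i<j\leq \pi(n)}C\left(\left\lfloor\frac{n}{p_{i}^{\acute{v}_{p_i}(n)}p_{j}^{\acute{v}_{p_j}(n)}}\right\rfloor, 2\right)-\dots + (-1)^{\pi(n)}C\left(\left\lfloor\frac{n}{\prod_{1\leq i\leq \pi(n)} p_i^{\acute{v}_{p_i}(n)}}\right\rfloor, 2\right),$$ where the general $k$-th term ($1\le k\le \pi(n)$) is $(-1)^k\sum_{1\le i_1<\dots<i_k\le \pi(n)} C\left(\left\lfloor n/\prod_{l=1}^k p_{i_l}^{\acute{v}_{p_{i_l}}(n)}\right\rfloor,2\right)$.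
   Context: All graphs are finite, simple and undirected, and $(a,b)$ denotes the greatest common divisor of $a$ and $b$. A graph $G=(V,E)$ of order $n$ is a Diophantine graph if there is a bijection $f:V\to\{1,2,\dots,n\}$ (a Diophantine labelling) such that $(f(u),f(v))\mid n$ for all $uv\in E$. It is a maximal Diophantine graph, denoted $(D_n,f)$ or simply $D_n$, if adding any new edge turns it into a non-Diophantine graph; thus two distinct vertices $u,v$ of $D_n$ are adjacent if and only if $(f(u),f(v))\mid n$. For a prime $p$, $v_p(n)$ is the $p$-adic valuation of $n$, and $\acute{v}_p(n):=v_p(n)+1$. The binomial coefficient is $C(m,r):=\binom{m}{r}$ if $m\ge r$ and $C(m,r):=0$ if $m<r$. *)

theory Defs
  imports Complex_Main "HOL-Computational_Algebra.Primes"
begin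

(* A finite simple undirected graph is given by its vertex set V and its edge set E,
   an edge being an unordered pair {u, v} of distinct vertices. *)

definition simple_graph :: "'a set \<Rightarrow> 'a set set \<Rightarrow> bool" where
  "simple_graph V E \<longleftrightarrow> finite V \<and> (\<forall>e\<in>E. \<exists>u\<in>V. \<exists>v\<in>V. u \<noteq> v \<and> e = {u, v})"

definition diophantine_labelling :: "'a set \<Rightarrow> 'a set set \<Rightarrow> ('a \<Rightarrow> nat) \<Rightarrow> bool" where
  "diophantine_labelling V E f \<longleftrightarrow>
     bij_betw f V {1..card V} \<and> (\<forall>u v. {u, v} \<in> E \<longrightarrow> gcd (f u) (f v) dvd card V)"

definition diophantine_graph :: "'a set \<Rightarrow> 'a set set \<Rightarrow> bool" where
  "diophantine_graph V E \<longleftrightarrow> simple_graph V E \<and> (\<exists>f. diophantine_labelling V E f)"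

(* The enlarged graph must have no Diophantine labelling at all, not merely fail to be
   labelled by a labelling of the original graph. *)

definition maximal_diophantine_graph :: "'a set \<Rightarrow> 'a set set \<Rightarrow> bool" where
  "maximal_diophantine_graph V E \<longleftrightarrow>
     diophantine_graph V E \<and>
     (\<forall>u\<in>V. \<forall>v\<in>V. u \<noteq> v \<and> {u, v} \<notin> E \<longrightarrow> \<not> diophantine_graph V (insert {u, v} E))"

definition prime_count :: "nat \<Rightarrow> nat" where
  "prime_count n = card {p. prime p \<and> p \<le> n}"

definition acute_v :: "nat \<Rightarrow> nat \<Rightarrow> nat" where
  "acute_v p n = multiplicity p n + 1"

end

theory Submission
  imports Defs
begin

text \<open>
  A labelling transports the edges of \<open>D\<^sub>n\<close> to the pairs \<open>{a, b}\<close> of distinct numbers up to \<open>n\<close>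
  with \<open>gcd a b dvd n\<close>. Such a pair is a non-edge iff, for some prime \<open>q \<le> n\<close>, both \<open>a\<close> and \<open>b\<close>
  are multiples of \<open>q ^ acute_v q n\<close>, the least power of \<open>q\<close> not dividing \<open>n\<close>. Prime powers of
  distinct primes are coprime, so being a multiple of several of them means being a multiple of
  their product, and inclusion-exclusion over the primes counts the non-edges.
\<close>

text \<open>Inclusion-exclusion over all nonempty index sets, regrouped by their size
  \<open>k\<close> to match the shape of the final formula. Starting at \<open>k = 1\<close> leaves
  out the empty index set, whose intersection would be \<open>UNIV\<close>.\<close>

lemma int_card_UN_inclusion_exclusion:
  fixes A :: "'i \<Rightarrow> 'b set"
  assumes "finite I" and "\<And>i. i \<in> I \<Longrightarrow> finite (A i)"
  shows "int (card (\<Union>i\<in>I. A i)) =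
    - (\<Sum>k = 1..card I. (- 1) ^ k * (\<Sum>J | J \<subseteq> I \<and> card J = k. int (card (\<Inter>i\<in>J. A i))))"
proof -
  interpret Incl_Excl finite "\<lambda>X :: 'b set. int (card X)"
    by unfold_locales (auto simp: card_Un_disjnt)
  let ?S = "{J. J \<subseteq> I \<and> J \<noteq> {}}"
  let ?g = "\<lambda>J. (- 1) ^ card J * int (card (\<Inter>i\<in>J. A i))"
  have finS: "finite ?S"
    using assms(1) by simp
  have card_range: "card ` ?S \<subseteq> {1..card I}"
  proof
    fix k assume "k \<in> card ` ?S"
    then obtain J where J: "J \<subseteq> I" "J \<noteq> {}" "k = card J"
      by blast
    moreover have "finite J"
      using J(1) assms(1) by (rule finite_subset)
    ultimately show "k \<in> {1..card I}"
      using assms(1) by (simp add: card_mono Suc_le_eq card_gt_0_iff)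
  qed
  have "int (card (\<Union>i\<in>I. A i)) = - (\<Sum>J\<in>?S. ?g J)"
    using restricted_indexed[of I A] assms by (simp add: sum_negf)
  also have "(\<Sum>J\<in>?S. ?g J) = (\<Sum>k = 1..card I. \<Sum>J | J \<in> ?S \<and> card J = k. ?g J)"
    using sum.group[OF finS _ card_range, of ?g] by simp
  also have "\<dots> = (\<Sum>k = 1..card I. (- 1) ^ k *
      (\<Sum>J | J \<subseteq> I \<and> card J = k. int (card (\<Inter>i\<in>J. A i))))"
    unfolding sum_distrib_left by (intro sum.cong) auto
  finally show ?thesis .
qed

lemma card_multiples:
  fixes d n :: nat
  assumes "d > 0"
  shows "card {k \<in> {1..n}. d dvd k} = n div d"
proof -
  have "{k \<in> {1..n}. d dvd k} = (*) d ` {1..n div d}"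
  proof (intro equalityI subsetI)
    fix k assume "k \<in> {k \<in> {1..n}. d dvd k}"
    then obtain m where "k = d * m" "1 \<le> k" "k \<le> n"
      by (auto elim: dvdE)
    with assms show "k \<in> (*) d ` {1..n div d}"
      by (auto simp: less_eq_div_iff_mult_less_eq mult.commute Suc_le_eq)
  qed (use assms in \<open>auto simp: less_eq_div_iff_mult_less_eq mult.commute Suc_le_eq\<close>)
  then show ?thesis
    using assms by (simp add: card_image inj_on_def)
qed

text \<open>Pairwise coprimality makes each new factor coprime to the product of the earlier ones.
  This turns an intersection of sets of multiples into a single set of multiples.\<close>

lemma prod_coprime_dvd_iff:
  fixes f :: "'i \<Rightarrow> nat"
  assumes "finite I" and "\<And>i j. i \<in> I \<Longrightarrow> j \<in> I \<Longrightarrow> i \<noteq> j \<Longrightarrow> coprime (f i) (f j)"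
  shows "(\<Prod>i\<in>I. f i) dvd x \<longleftrightarrow> (\<forall>i\<in>I. f i dvd x)"
  using assms
proof (induction I rule: finite_induct)
  case (insert i I)
  then have "coprime (f i) (\<Prod>j\<in>I. f j)"
    by (intro prod_coprime_right) auto
  with insert show ?case
    by (auto intro: divides_mult dvd_mult_left dvd_mult_right)
qed simp

text \<open>Divisibility fails exactly when some prime has larger multiplicity in \<open>g\<close>
  than in \<open>n\<close>, that is, at least \<open>acute_v q n\<close>.\<close>

lemma not_dvd_iff_acute_power_dvd:
  assumes "g > 0" and "n > 0"
  shows "\<not> g dvd n \<longleftrightarrow> (\<exists>q. prime q \<and> q ^ acute_v q n dvd g)"
proof
  assume "\<not> g dvd n"
  then obtain q where q: "prime q" "multiplicity q n < multiplicity q g"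
    using multiplicity_le_imp_dvd[of g n] assms by (metis not_less less_numeral_extra(3))
  then have "q ^ acute_v q n dvd g"
    by (intro multiplicity_dvd') (simp add: acute_v_def)
  with q show "\<exists>q. prime q \<and> q ^ acute_v q n dvd g"
    by blast
next
  assume "\<exists>q. prime q \<and> q ^ acute_v q n dvd g"
  then obtain q where q: "prime q" "q ^ acute_v q n dvd g"
    by blast
  show "\<not> g dvd n"
  proof
    assume "g dvd n"
    with q have "q ^ Suc (multiplicity q n) dvd n"
      by (auto simp: acute_v_def intro: dvd_trans)
    with q assms show False
      by (subst (asm) power_dvd_iff_le_multiplicity) (auto simp: prime_gt_1_nat)
  qed
qed

text \<open>If the gcd condition holds, \<open>f\<close> itself still labels the graph enlarged by
  \<open>{u, v}\<close>, so maximality forces this edge to be present already. Hence any labelling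
  determines \<open>E\<close>.\<close>

lemma maximal_diophantine_edge_iff:
  assumes "maximal_diophantine_graph V E" and "diophantine_labelling V E f"
    and "u \<in> V" "v \<in> V" "u \<noteq> v"
  shows "{u, v} \<in> E \<longleftrightarrow> gcd (f u) (f v) dvd card V"
proof
  assume "{u, v} \<in> E"
  then show "gcd (f u) (f v) dvd card V"
    using assms(2) by (simp add: diophantine_labelling_def)
next
  assume gcd: "gcd (f u) (f v) dvd card V"
  have "diophantine_labelling V (insert {u, v} E) f"
    using assms(2) gcd by (auto simp: diophantine_labelling_def doubleton_eq_iff gcd.commute)
  moreover have "simple_graph V (insert {u, v} E)"
    using assms by (auto simp: maximal_diophantine_graph_def diophantine_graph_def simple_graph_def)
  ultimately show "{u, v} \<in> E"
    using assms by (auto simp: maximal_diophantine_graph_def diophantine_graph_def)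
qed

text \<open>Unordered pairs as sets let \<open>Gcd e\<close> stand for the gcd of the two labels,
  and make \<open>pairs_in\<close> commute with nonempty intersections.\<close>

definition pairs_in :: "nat set \<Rightarrow> nat set set" where
  "pairs_in X = {e. e \<subseteq> X \<and> card e = 2}"

lemma card_pairs_in: "finite X \<Longrightarrow> card (pairs_in X) = card X choose 2"
  by (simp add: pairs_in_def n_subsets)

lemma finite_pairs_in: "finite X \<Longrightarrow> finite (pairs_in X)"
  by (simp add: pairs_in_def)

text \<open>Taking images of edges under a labelling \<open>f\<close> is injective because
  \<open>f\<close> is, and it hits exactly the admissible pairs of labels.\<close>

lemma card_edges_maximal_diophantine:
  assumes "maximal_diophantine_graph V E" and "card V = n"
  shows "card E = card {e \<in> pairs_in {1..n}. Gcd e dvd n}"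
proof -
  obtain f where f: "diophantine_labelling V E f" and simple: "simple_graph V E"
    using assms(1) by (auto simp: maximal_diophantine_graph_def diophantine_graph_def)
  have bij: "bij_betw f V {1..n}"
    using f assms(2) by (simp add: diophantine_labelling_def)
  then have inj: "inj_on f V" and img: "f ` V = {1..n}"
    by (auto simp: bij_betw_def)
  note edge_iff = maximal_diophantine_edge_iff[OF assms(1) f, unfolded assms(2)]
  have edges: "\<exists>u\<in>V. \<exists>v\<in>V. u \<noteq> v \<and> e = {u, v}" if "e \<in> E" for e
    using that simple by (simp add: simple_graph_def)
  have "(`) f ` E = {e \<in> pairs_in {1..n}. Gcd e dvd n}"
  proof (intro equalityI subsetI)
    fix e assume "e \<in> (`) f ` E"
    then obtain u v where uv: "u \<in> V" "v \<in> V" "u \<noteq> v" "{u, v} \<in> E" "e = {f u, f v}"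
      using edges by force
    moreover have "f u \<noteq> f v"
      using inj uv by (auto dest: inj_onD)
    moreover have "f u \<in> {1..n}" "f v \<in> {1..n}"
      using img uv by blast+
    ultimately show "e \<in> {e \<in> pairs_in {1..n}. Gcd e dvd n}"
      using edge_iff by (auto simp: pairs_in_def)
  next
    fix e assume "e \<in> {e \<in> pairs_in {1..n}. Gcd e dvd n}"
    then obtain a b where ab: "e = {a, b}" "a \<noteq> b" "a \<in> f ` V" "b \<in> f ` V" "gcd a b dvd n"
      by (auto simp: pairs_in_def card_2_iff img)
    then obtain u v where "u \<in> V" "v \<in> V" "a = f u" "b = f v"
      by blast
    moreover from this ab have "{u, v} \<in> E"
      using edge_iff by blast
    ultimately show "e \<in> (`) f ` E"
      using ab by (auto intro: rev_image_eqI)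
  qed
  moreover have "inj_on ((`) f) E"
    using edges by (intro inj_on_subset[OF inj_on_image_Pow[OF inj]]) blast
  ultimately show ?thesis
    by (metis card_image)
qed

theorem theorem3p1:
  fixes V :: "'a set" and E :: "'a set set" and n :: nat and p :: "nat \<Rightarrow> nat"
  assumes "n > 0"
    and "maximal_diophantine_graph V E"
    and "card V = n"
    and "bij_betw p {1..prime_count n} {q. prime q \<and> q \<le> n}"
  shows "int (card E) =
    int (n choose 2) +
    (\<Sum>k = 1..prime_count n. (-1) ^ k *
       (\<Sum>I | I \<subseteq> {1..prime_count n} \<and> card I = k.
          int ((n div (\<Prod>i\<in>I. p i ^ acute_v (p i) n)) choose 2)))"
proof -
  define R where "R = {1..prime_count n}"
  define d where "d = (\<lambda>i. p i ^ acute_v (p i) n)"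
  define M where "M = (\<lambda>m. {k \<in> {1..n}. m dvd k})"
  \<comment> \<open>\<open>A i\<close> consists of the pairs kept non-adjacent by the prime
    \<open>p i\<close>.\<close>
  define A where "A = (\<lambda>i. pairs_in (M (d i)))"
  have inj: "inj_on p R" and img: "p ` R = {q. prime q \<and> q \<le> n}"
    using assms(4) by (auto simp: bij_betw_def R_def)
  then have prime: "prime (p i)" if "i \<in> R" for i
    using that by blast
  have d_pos: "d i > 0" if "i \<in> R" for i
    using prime[OF that] by (simp add: d_def prime_gt_0_nat)
  have d_coprime: "coprime (d i) (d j)" if "i \<in> R" "j \<in> R" "i \<noteq> j" for i j
  proof -
    have "p i \<noteq> p j"
      using inj that by (auto dest: inj_onD)
    then show ?thesis
      using prime that by (simp add: d_def primes_coprime)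
  qed
  have finM: "finite (M m)" for m
    by (simp add: M_def)
  have finA: "finite (A i)" for i
    by (simp add: A_def finite_pairs_in finM)
  have inter: "card (\<Inter>i\<in>J. A i) = (n div (\<Prod>i\<in>J. d i)) choose 2" if "J \<subseteq> R" "J \<noteq> {}" for J
  proof -
    have finJ: "finite J"
      using that by (auto simp: R_def intro: finite_subset)
    have "(\<Prod>i\<in>J. d i) dvd k \<longleftrightarrow> (\<forall>i\<in>J. d i dvd k)" for k
      using finJ d_coprime that by (intro prod_coprime_dvd_iff) auto
    then have "(\<Inter>i\<in>J. A i) = pairs_in (M (\<Prod>i\<in>J. d i))"
      using that by (auto simp: A_def pairs_in_def M_def)
    moreover have "(\<Prod>i\<in>J. d i) > 0"
      by (rule prod_pos) (use d_pos that(1) in auto)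
    then have "card (M (\<Prod>i\<in>J. d i)) = n div (\<Prod>i\<in>J. d i)"
      unfolding M_def by (rule card_multiples)
    ultimately show ?thesis
      by (simp add: card_pairs_in finM)
  qed
  have nonedge: "\<not> Gcd e dvd n \<longleftrightarrow> (\<exists>i\<in>R. e \<in> A i)" if e: "e \<in> pairs_in {1..n}" for e
  proof -
    obtain a where a: "a \<in> e" "1 \<le> a" "a \<le> n"
      using e by (fastforce simp: pairs_in_def card_2_iff)
    have "Gcd e dvd a"
      using a by (intro Gcd_dvd)
    with a have "Gcd e > 0"
      using dvd_pos_nat[of a] by simp
    then have "\<not> Gcd e dvd n \<longleftrightarrow> (\<exists>q. prime q \<and> q ^ acute_v q n dvd Gcd e)"
      using assms(1) by (rule not_dvd_iff_acute_power_dvd)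
    \<comment> \<open>Only primes up to \<open>n\<close> matter: the exponent is at least 1, so
      \<open>q\<close> divides the element \<open>a\<close> of \<open>e\<close>, and
      \<open>a \<le> n\<close>.\<close>
    also have "\<dots> \<longleftrightarrow> (\<exists>q\<in>p ` R. q ^ acute_v q n dvd Gcd e)"
    proof -
      have "q \<le> n" if "q ^ acute_v q n dvd Gcd e" for q
      proof -
        have "q dvd q ^ acute_v q n"
          by (simp add: acute_v_def)
        with that \<open>Gcd e dvd a\<close> have "q dvd a"
          by (meson dvd_trans)
        with a show ?thesis
          by (auto dest: dvd_imp_le)
      qed
      then show ?thesis
        unfolding img by blast
    qed
    also have "\<dots> \<longleftrightarrow> (\<exists>i\<in>R. d i dvd Gcd e)"
      by (simp add: d_def)
    \<comment> \<open>A number divides \<open>Gcd e\<close> iff it divides both elements of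
      \<open>e\<close>, so \<open>e\<close> lies within \<open>M (d i)\<close>.\<close>
    also have "\<dots> \<longleftrightarrow> (\<exists>i\<in>R. e \<in> A i)"
      using e unfolding dvd_Gcd_iff A_def M_def pairs_in_def by blast
    finally show ?thesis .
  qed
  have sub: "(\<Union>i\<in>R. A i) \<subseteq> pairs_in {1..n}"
    by (auto simp: A_def M_def pairs_in_def)
  have "{e \<in> pairs_in {1..n}. Gcd e dvd n} = pairs_in {1..n} - (\<Union>i\<in>R. A i)"
    using nonedge by blast
  then have "card E = card (pairs_in {1..n} - (\<Union>i\<in>R. A i))"
    using card_edges_maximal_diophantine[OF assms(2,3)] by simp
  also have "int \<dots> = int (card (pairs_in {1..n})) - int (card (\<Union>i\<in>R. A i))"
    using sub finA by (subst card_Diff_subset)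
      (auto simp: R_def of_nat_diff card_mono finite_pairs_in)
  also have "card (pairs_in {1..n}) = n choose 2"
    by (simp add: card_pairs_in)
  also have "int (card (\<Union>i\<in>R. A i)) = - (\<Sum>k = 1..card R. (- 1) ^ k *
      (\<Sum>J | J \<subseteq> R \<and> card J = k. int (card (\<Inter>i\<in>J. A i))))"
    using finA by (intro int_card_UN_inclusion_exclusion) (auto simp: R_def)
  also have "(\<Sum>k = 1..card R. (- 1) ^ k *
      (\<Sum>J | J \<subseteq> R \<and> card J = k. int (card (\<Inter>i\<in>J. A i)))) =
    (\<Sum>k = 1..card R. (- 1) ^ k *
      (\<Sum>J | J \<subseteq> R \<and> card J = k. int ((n div (\<Prod>i\<in>J. d i)) choose 2)))"
  proof (intro sum.cong refl arg_cong2[where f = "(*)"])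
    fix k J
    assume "k \<in> {1..card R}" "J \<in> {J. J \<subseteq> R \<and> card J = k}"
    \<comment> \<open>Since \<open>k \<ge> 1\<close>, the index set is nonempty, as
      \<open>inter\<close> requires.\<close>
    then have "J \<subseteq> R" "J \<noteq> {}"
      by auto
    then show "int (card (\<Inter>i\<in>J. A i)) = int ((n div (\<Prod>i\<in>J. d i)) choose 2)"
      by (simp add: inter)
  qed
  finally show ?thesis
    by (simp add: R_def d_def)
qed

end
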